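(* Let $n\ge 2$ and let $\Omega\subseteq\mathbb{R}^n$, $F$, $g$, $\varphi$ satisfy the following assumptions. (A1) $\Omega$ is a uniformly convex domain of class $C^2$ (with non-empty boundary), i.e. all principal curvatures $\kappa_1,\dots,\kappa_{n-1}$ of $\partial\Omega$ are bounded below by a positive constant. (A2)-(ii) $F\in C(\mathbb{R}^n)$; $F(\lambda_1(A),\dots,\lambda_n(A))\ge F(\lambda_1(B),\dots,\lambda_n(B))$ for all positive semi-definite $n\times n$ matrices $A,B$ with $A-B$ positive semi-definite; and there exist constants $\Lambda_0>0$, $a\ge 0$, $b>0$ such that $F(\lambda_1(A),\dots,\lambda_n(A))\le \Lambda_0(\lambda_{\min}(A))^a(\lambda_{\max}(A))^b$ for all positive semi-definite $A$ (in particular for $A=D^2u$, $u$ convex). (A3) $g\in C(\overline\Omega)$ and there are constants $0<m_0\le M_0$ with $m_0\le g(x)\le M_0$ for all $x\in\overline\Omega$. (A4) $\varphi\in C(\partial\Omega)$ and there is a convex function $\varphi_*\in C(\overline\Omega)$ with $\varphi_*|_{\partial\Omega}=\varphi$. Let $d(x)=\operatorname{dist}(x,\partial\Omega)$. If $\alpha\in(-\infty,-a-2b]$, then the Dirichlet problem $$F(\lambda_1(D^2u),\dots,\lambda_n(D^2u))=g(x)(d(x))^{\alpha}\ \text{ in }\Omega,\qquad u=\varphi\ \text{ on }\partial\Omega$$ does not admit any viscosity solution, and consequently it does not admit any classical solution.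
   Context: For a symmetric matrix $A$, $\lambda_1(A)\le\cdots\le\lambda_n(A)$ are its eigenvalues, $\lambda_{\min}(A)$ and $\lambda_{\max}(A)$ the smallest and largest ones; $t^0=1$. Classical solutions: a convex function $u\in C^2(\Omega)\cap C(\overline\Omega)$ satisfying the equation pointwise in $\Omega$ and $u=\varphi$ on $\partial\Omega$. Viscosity solutions: let $u\in C(\overline\Omega)$ be a convex function. $u$ is a viscosity sub-solution (resp. super-solution) of $F(\lambda_1(D^2u),\dots,\lambda_n(D^2u))=g(x)(d(x))^\alpha$ over $\Omega$ if for every $x_0\in\Omega$, every open neighborhood $U(x_0)\subset\Omega$ of $x_0$ and every convex $\phi\in C^2(U(x_0))$ with $(\phi-u)(x)\ge(\phi-u)(x_0)$ (resp. $\le$) for all $x\in U(x_0)$, one has $F(\lambda_1(D^2\phi(x_0)),\dots,\lambda_n(D^2\phi(x_0)))\ge g(x_0)(d(x_0))^\alpha$ (resp. $\le$). $u$ is a viscosity solution of the equation if it is both; it is a viscosity solution of the Dirichlet problem if moreover $u=\varphi$ on $\partial\Omega$. *)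

theory Defs
  imports
    "HOL-Analysis.Analysis"
    "HOL-Computational_Algebra.Polynomial"
begin

section \<open>Eigenvalues of symmetric matrices\<close>

text \<open>
  The index type carries a linear order, which is only used to list eigenvalues in
  increasing order as the coordinates of a vector.
\<close>

definition charpoly :: "real^'n^'n \<Rightarrow> real poly" where
  "charpoly A = det (\<chi> i j. (if i = j then [:0, 1:] else 0) - [:A $ i $ j:])"

text \<open>Algebraic multiplicities; for symmetric matrices there are exactly \<open>CARD('n)\<close> real
  eigenvalues, and algebraic and geometric multiplicities agree.\<close>

definition eigenvalues :: "real^'n^'n \<Rightarrow> real multiset" where
  "eigenvalues A = proots (charpoly A)"

text \<open>The vector \<open>(\<lambda>\<^sub>1, \<dots>, \<lambda>\<^sub>n)\<close> with \<open>\<lambda>\<^sub>1 \<le> \<dots> \<le> \<lambda>\<^sub>n\<close>; the number \<open>card {..<i}\<close> is the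
  zero-based position of the index \<open>i\<close>.\<close>

definition eigenvalue_vec :: "((real, 'n) vec, 'n) vec \<Rightarrow> real^('n::{finite,linorder})" where
  "eigenvalue_vec A = (\<chi> i. sorted_list_of_multiset (eigenvalues A) ! card {..<i})"

definition lambda_min :: "real^'n^'n \<Rightarrow> real" where
  "lambda_min A = Min (set_mset (eigenvalues A))"

definition lambda_max :: "real^'n^'n \<Rightarrow> real" where
  "lambda_max A = Max (set_mset (eigenvalues A))"

definition pos_semidef :: "real^'n^'n \<Rightarrow> bool" where
  "pos_semidef A \<longleftrightarrow> transpose A = A \<and> (\<forall>x. 0 \<le> x \<bullet> (A *v x))"

text \<open>Power of a nonnegative base with the convention \<open>t\<^sup>0 = 1\<close> also for \<open>t = 0\<close>
  (whereas \<open>0 powr 0 = 0\<close>).\<close>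

definition rpow :: "real \<Rightarrow> real \<Rightarrow> real" where
  "rpow t s = (if s = 0 then 1 else t powr s)"

section \<open>Twice continuously differentiable functions\<close>

definition grad :: "(real^'n \<Rightarrow> real) \<Rightarrow> real^'n \<Rightarrow> real^'n" where
  "grad f x = (\<chi> i. frechet_derivative f (at x) (axis i 1))"

definition hessian :: "(real^'n \<Rightarrow> real) \<Rightarrow> real^'n \<Rightarrow> real^'n^'n" where
  "hessian f x = jacobian (grad f) (at x)"

text \<open>Meant for open sets.\<close>

definition C2_on :: "(real^'n) set \<Rightarrow> (real^'n \<Rightarrow> real) \<Rightarrow> bool" where
  "C2_on U f \<longleftrightarrow>
     (\<forall>x\<in>U. f differentiable (at x)) \<and>
     (\<forall>x\<in>U. grad f differentiable (at x)) \<and>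
     continuous_on U (hessian f)"

section \<open>Uniformly convex domains of class \<open>C\<^sup>2\<close>\<close>

text \<open>A local defining function near the boundary point \<open>p\<close>. Since the gradient does not
  vanish, \<open>{x \<in> U. \<rho> x = 0}\<close> is the part of the boundary in \<open>U\<close>, and
  \<open>grad \<rho> x /\<^sub>R norm (grad \<rho> x)\<close> is the outer unit normal there.\<close>

definition C2_defining_function ::
  "(real^'n) set \<Rightarrow> real^'n \<Rightarrow> (real^'n) set \<Rightarrow> (real^'n \<Rightarrow> real) \<Rightarrow> bool" where
  "C2_defining_function \<Omega> p U \<rho> \<longleftrightarrow>
     open U \<and> p \<in> U \<and> C2_on U \<rho> \<and> (\<forall>x\<in>U. grad \<rho> x \<noteq> 0) \<and> \<Omega> \<inter> U = {x \<in> U. \<rho> x < 0}"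

definition C2_domain :: "(real^'n) set \<Rightarrow> bool" where
  "C2_domain \<Omega> \<longleftrightarrow>
     open \<Omega> \<and> connected \<Omega> \<and> \<Omega> \<noteq> {} \<and>
     (\<forall>p\<in>frontier \<Omega>. \<exists>U \<rho>. C2_defining_function \<Omega> p U \<rho>)"

text \<open>The principal curvatures at \<open>p\<close> are the eigenvalues of the shape operator, i.e. of the
  derivative of the outer unit normal field restricted to the tangent space at \<open>p\<close>. On tangent
  vectors this derivative depends only on the values of the normal field on the boundary, so the
  choice of \<open>\<rho>\<close> is irrelevant. With this sign, spheres of radius \<open>r\<close> bounding balls have
  principal curvatures \<open>1 / r\<close>.\<close>

definition principal_curvature :: "(real^'n) set \<Rightarrow> real^'n \<Rightarrow> real \<Rightarrow> bool" where
  "principal_curvature \<Omega> p \<kappa> \<longleftrightarrow>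
     (\<exists>U \<rho> v. C2_defining_function \<Omega> p U \<rho> \<and> v \<noteq> 0 \<and> v \<bullet> grad \<rho> p = 0 \<and>
        frechet_derivative (\<lambda>x. grad \<rho> x /\<^sub>R norm (grad \<rho> x)) (at p) v = \<kappa> *\<^sub>R v)"

definition uniformly_convex_C2_domain :: "(real^'n) set \<Rightarrow> bool" where
  "uniformly_convex_C2_domain \<Omega> \<longleftrightarrow>
     C2_domain \<Omega> \<and> frontier \<Omega> \<noteq> {} \<and>
     (\<exists>k>0. \<forall>p\<in>frontier \<Omega>. \<forall>\<kappa>. principal_curvature \<Omega> p \<kappa> \<longrightarrow> k \<le> \<kappa>)"

section \<open>Solutions of \<open>F (\<lambda>\<^sub>1(D\<^sup>2u), \<dots>, \<lambda>\<^sub>n(D\<^sup>2u)) = f\<close>\<close>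

definition classical_solution ::
  "(real^('n::{finite,linorder}) \<Rightarrow> real) \<Rightarrow> ((real, 'n) vec \<Rightarrow> real) \<Rightarrow> (real, 'n) vec set \<Rightarrow>
   ((real, 'n) vec \<Rightarrow> real) \<Rightarrow> ((real, 'n) vec \<Rightarrow> real) \<Rightarrow> bool" where
  "classical_solution F f \<Omega> \<phi> u \<longleftrightarrow>
     convex_on (closure \<Omega>) u \<and> continuous_on (closure \<Omega>) u \<and> C2_on \<Omega> u \<and>
     (\<forall>x\<in>\<Omega>. F (eigenvalue_vec (hessian u x)) = f x) \<and>
     (\<forall>x\<in>frontier \<Omega>. u x = \<phi> x)"

text \<open>\<^const>\<open>convex_on\<close> makes the neighbourhoods \<open>U\<close> below convex. This is no restriction: a convex
  test function on any other neighbourhood can be restricted to a ball around \<open>x\<^sub>0\<close>.\<close>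

definition viscosity_subsolution ::
  "(real^('n::{finite,linorder}) \<Rightarrow> real) \<Rightarrow> ((real, 'n) vec \<Rightarrow> real) \<Rightarrow> (real, 'n) vec set \<Rightarrow>
   ((real, 'n) vec \<Rightarrow> real) \<Rightarrow> bool" where
  "viscosity_subsolution F f \<Omega> u \<longleftrightarrow>
     convex_on (closure \<Omega>) u \<and> continuous_on (closure \<Omega>) u \<and>
     (\<forall>x\<^sub>0\<in>\<Omega>. \<forall>U \<psi>. open U \<and> x\<^sub>0 \<in> U \<and> U \<subseteq> \<Omega> \<and> convex_on U \<psi> \<and> C2_on U \<psi> \<and>
        (\<forall>x\<in>U. \<psi> x - u x \<ge> \<psi> x\<^sub>0 - u x\<^sub>0) \<longrightarrow>
        F (eigenvalue_vec (hessian \<psi> x\<^sub>0)) \<ge> f x\<^sub>0)"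

definition viscosity_supersolution ::
  "(real^('n::{finite,linorder}) \<Rightarrow> real) \<Rightarrow> ((real, 'n) vec \<Rightarrow> real) \<Rightarrow> (real, 'n) vec set \<Rightarrow>
   ((real, 'n) vec \<Rightarrow> real) \<Rightarrow> bool" where
  "viscosity_supersolution F f \<Omega> u \<longleftrightarrow>
     convex_on (closure \<Omega>) u \<and> continuous_on (closure \<Omega>) u \<and>
     (\<forall>x\<^sub>0\<in>\<Omega>. \<forall>U \<psi>. open U \<and> x\<^sub>0 \<in> U \<and> U \<subseteq> \<Omega> \<and> convex_on U \<psi> \<and> C2_on U \<psi> \<and>
        (\<forall>x\<in>U. \<psi> x - u x \<le> \<psi> x\<^sub>0 - u x\<^sub>0) \<longrightarrow>
        F (eigenvalue_vec (hessian \<psi> x\<^sub>0)) \<le> f x\<^sub>0)"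

definition viscosity_solution ::
  "(real^('n::{finite,linorder}) \<Rightarrow> real) \<Rightarrow> ((real, 'n) vec \<Rightarrow> real) \<Rightarrow> (real, 'n) vec set \<Rightarrow>
   ((real, 'n) vec \<Rightarrow> real) \<Rightarrow> ((real, 'n) vec \<Rightarrow> real) \<Rightarrow> bool" where
  "viscosity_solution F f \<Omega> \<phi> u \<longleftrightarrow>
     viscosity_subsolution F f \<Omega> u \<and> viscosity_supersolution F f \<Omega> u \<and>
     (\<forall>x\<in>frontier \<Omega>. u x = \<phi> x)"

end

theory Submission
  imports Defs
begin

text \<open>
  Let \<open>p\<close> be a boundary point touched by an interior ball and let \<open>e\<close> be the outer normal there.
  At depth \<open>t\<close> below \<open>p\<close> the domain contains an ellipsoid of size \<open>t\<close> in direction \<open>e\<close> and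
  \<open>\<surd>t\<close> in the tangential directions, and by continuity of \<open>u\<close> at \<open>p\<close> the oscillation of \<open>u\<close> on it
  is at most some \<open>\<epsilon>\<close> that tends to \<open>0\<close> with \<open>t\<close>. A paraboloid that rises by \<open>\<epsilon>\<close> over the ellipsoid
  therefore touches \<open>u\<close> from above at an interior point. Its Hessian has smallest eigenvalue of order
  \<open>\<epsilon> / t\<close> (here \<open>n \<ge> 2\<close> enters) and largest of order \<open>\<epsilon> / t\<^sup>2\<close>, so the growth of \<open>F\<close> bounds the left-hand
  side by a multiple of \<open>\<epsilon>\<^bsup>a+b\<^esup> t\<^bsup>-a-2b\<^esup>\<close>. Convexity of the domain puts the touching point at distance
  at most \<open>5t/4\<close> from the boundary, so the right-hand side is at least a multiple of
  \<open>t\<^bsup>-a-2b\<^esup>\<close>: a contradiction for small \<open>\<epsilon>\<close>. Classical solutions are subsolutions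
  because \<open>F\<close> is monotone and Hessians are symmetric, so they are covered as well.
\<close>

section \<open>Spectra of symmetric matrices\<close>

text \<open>The matrix \<open>\<mu> I + \<beta> e e^T\<close>, the Hessian of the barriers: one
  direction can be made steeper than the others while the spectrum stays explicit.\<close>

definition stretch :: "real \<Rightarrow> real \<Rightarrow> real^'n \<Rightarrow> real^'n^'n" where
  "stretch \<mu> \<beta> e = (\<chi> i j. (if i = j then \<mu> else 0) + \<beta> * e $ i * e $ j)"

lemma stretch_mult_vec: "stretch \<mu> \<beta> e *v x = \<mu> *\<^sub>R x + (\<beta> * (e \<bullet> x)) *\<^sub>R e"
proof -
  have "(stretch \<mu> \<beta> e *v x) $ i = \<mu> * x $ i + \<beta> * (e \<bullet> x) * e $ i" for i
  proof -
    have "(stretch \<mu> \<beta> e *v x) $ i =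
        (\<Sum>j\<in>UNIV. (if i = j then \<mu> * x $ j else 0) + \<beta> * e $ i * (e $ j * x $ j))"
      by (auto simp: stretch_def matrix_vector_mult_def distrib_right intro!: sum.cong)
    then show ?thesis
      by (simp add: sum.distrib inner_vec_def sum_distrib_left[symmetric] mult.commute
          mult.left_commute[of _ "e $ i"])
  qed
  then show ?thesis
    by (simp add: vec_eq_iff)
qed

lemma transpose_stretch: "transpose (stretch \<mu> \<beta> e) = stretch \<mu> \<beta> e"
  by (auto simp: stretch_def transpose_def vec_eq_iff)

lemma inner_stretch: "x \<bullet> (stretch \<mu> \<beta> e *v x) = \<mu> * (norm x)\<^sup>2 + \<beta> * (e \<bullet> x)\<^sup>2"
  unfolding power2_norm_eq_inner
  by (simp add: stretch_mult_vec inner_right_distrib power2_eq_square inner_commute)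

lemma pos_semidef_stretch: "0 \<le> \<mu> \<Longrightarrow> 0 \<le> \<beta> \<Longrightarrow> pos_semidef (stretch \<mu> \<beta> e)"
  by (simp add: pos_semidef_def transpose_stretch inner_stretch)

lemma poly_charpoly: "poly (charpoly A) x = det (mat x - A)"
  unfolding charpoly_def det_def poly_sum poly_mult poly_prod poly_of_int
  by (intro sum.cong prod.cong arg_cong2[where f="(*)"]) (auto simp: mat_def)

lemma charpoly_root_iff:
  fixes A :: "real^'n^'n"
  shows "poly (charpoly A) x = 0 \<longleftrightarrow> (\<exists>v. v \<noteq> 0 \<and> A *v v = x *\<^sub>R v)"
proof -
  have "det (mat x - A) = 0 \<longleftrightarrow> (\<exists>v. v \<noteq> 0 \<and> (mat x - A) *v v = 0)"
    using det_nz_iff_inj[of "(*v) (mat x - A)"] linear_injective_0[of "(*v) (mat x - A)"]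
    by auto
  moreover have "(mat x - A) *v v = x *\<^sub>R v - A *v v" for v
    \<comment> \<open>\<open>stretch x 0 0\<close> is the scalar matrix
      \<open>mat x\<close>.\<close>
    using stretch_mult_vec[of x 0 0 v]
    by (simp add: matrix_vector_mult_diff_rdistrib stretch_def mat_def)
  ultimately show ?thesis
    by (auto simp: poly_charpoly)
qed

text \<open>No eigenvalue exceeds the operator norm, so one unit beyond it the polynomial does not
  vanish. Being nonzero is what makes the members of \<open>proots\<close> exactly its
  roots.\<close>

lemma charpoly_nonzero:
  fixes A :: "real^'n^'n"
  shows "charpoly A \<noteq> 0"
proof
  assume "charpoly A = 0"
  then obtain v where v: "v \<noteq> 0" "A *v v = (onorm ((*v) A) + 1) *\<^sub>R v"
    using charpoly_root_iff[of A "onorm ((*v) A) + 1"] by auto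
  have "norm (A *v v) \<le> onorm ((*v) A) * norm v"
    by (rule onorm) (rule matrix_vector_mul_bounded_linear)
  moreover have "0 \<le> onorm ((*v) A)"
    by (rule onorm_pos_le) (rule matrix_vector_mul_bounded_linear)
  ultimately have "(onorm ((*v) A) + 1) * norm v \<le> onorm ((*v) A) * norm v"
    by (simp add: v(2))
  then show False
    using v(1) by (simp add: algebra_simps)
qed

lemma set_eigenvalues:
  fixes A :: "real^'n^'n"
  shows "set_mset (eigenvalues A) = {x. \<exists>v. v \<noteq> 0 \<and> A *v v = x *\<^sub>R v}"
  by (simp add: eigenvalues_def charpoly_nonzero charpoly_root_iff)

text \<open>Pairing the eigenvalue equation with \<open>e\<close> leaves two cases: an eigenvector
  orthogonal to \<open>e\<close>, with eigenvalue \<open>\<mu>\<close>, or one with a component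
  along \<open>e\<close>, with eigenvalue \<open>\<mu> + \<beta>\<close>.\<close>

lemma eigenvalues_stretch:
  fixes e :: "real^'n"
  assumes "CARD('n) \<ge> 2" "norm e = 1"
  shows "set_mset (eigenvalues (stretch \<mu> \<beta> e)) = {\<mu>, \<mu> + \<beta>}"
proof -
  have ee: "e \<bullet> e = 1"
    using assms(2) by (simp add: norm_eq_1)
  have sub: "x = \<mu> \<or> x = \<mu> + \<beta>" if v: "v \<noteq> 0" "stretch \<mu> \<beta> e *v v = x *\<^sub>R v" for x v
  proof -
    have *: "(x - \<mu>) *\<^sub>R v = (\<beta> * (e \<bullet> v)) *\<^sub>R e"
      using v(2) by (simp add: stretch_mult_vec algebra_simps)
    then have "e \<bullet> ((x - \<mu>) *\<^sub>R v) = e \<bullet> ((\<beta> * (e \<bullet> v)) *\<^sub>R e)"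
      by simp
    then have "(x - \<mu>) * (e \<bullet> v) = \<beta> * (e \<bullet> v)"
      by (simp add: ee)
    then show ?thesis
      using * v(1) by (cases "e \<bullet> v = 0") auto
  qed
  \<comment> \<open>Dimension at least two supplies the eigenvector for \<open>\<mu>\<close>; on a
    line only \<open>\<mu> + \<beta>\<close> would occur.\<close>
  obtain w where w: "w \<noteq> 0" "orthogonal e w"
    using orthogonal_to_vector_exists[of e] assms(1) by auto
  have "stretch \<mu> \<beta> e *v w = \<mu> *\<^sub>R w"
    using w(2) by (simp add: stretch_mult_vec orthogonal_def)
  moreover have "stretch \<mu> \<beta> e *v e = (\<mu> + \<beta>) *\<^sub>R e"
    by (simp add: stretch_mult_vec ee algebra_simps)
  moreover have "e \<noteq> 0"
    using assms(2) by auto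
  ultimately show ?thesis
    unfolding set_eigenvalues using sub w(1) by blast
qed

lemma lambda_stretch:
  fixes e :: "real^'n"
  assumes "CARD('n) \<ge> 2" "norm e = 1" "0 \<le> \<beta>"
  shows "lambda_min (stretch \<mu> \<beta> e) = \<mu>" "lambda_max (stretch \<mu> \<beta> e) = \<mu> + \<beta>"
  using assms by (simp_all add: lambda_min_def lambda_max_def eigenvalues_stretch)

section \<open>Second derivatives\<close>

lemma has_derivative_grad:
  fixes f :: "real^'n \<Rightarrow> real"
  assumes "f differentiable (at x)"
  shows "(f has_derivative (\<lambda>h. grad f x \<bullet> h)) (at x)"
proof -
  let ?D = "frechet_derivative f (at x)"
  have D: "(f has_derivative ?D) (at x)"
    using assms by (simp add: frechet_derivative_works)
  then have "linear ?D"
    by (rule has_derivative_linear)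
  have "?D h = grad f x \<bullet> h" for h
  proof -
    have "?D h = ?D (\<Sum>i\<in>UNIV. h $ i *\<^sub>R axis i 1)"
      using basis_expansion[of h] by (simp add: scalar_mult_eq_scaleR)
    also have "\<dots> = (\<Sum>i\<in>UNIV. h $ i * ?D (axis i 1))"
      using \<open>linear ?D\<close> by (simp add: linear_sum linear_cmul)
    finally show ?thesis
      by (simp add: grad_def inner_vec_def mult.commute)
  qed
  then have "?D = (\<lambda>h. grad f x \<bullet> h)" ..
  then show ?thesis
    using D by simp
qed

lemma grad_eqI:
  fixes f :: "real^'n \<Rightarrow> real"
  assumes "(f has_derivative (\<lambda>h. G \<bullet> h)) (at x)"
  shows "grad f x = G"
  using frechet_derivative_at[OF assms, symmetric] by (simp add: grad_def vec_eq_iff inner_axis)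

lemma hessian_eqI:
  fixes f :: "real^'n \<Rightarrow> real"
  assumes "(grad f has_derivative (*v) A) (at x)"
  shows "hessian f x = A"
  using frechet_derivative_at[OF assms, symmetric]
  by (simp add: hessian_def jacobian_def)

lemma has_derivative_hessian:
  assumes "grad f differentiable (at x)"
  shows "(grad f has_derivative (*v) (hessian f x)) (at x)"
  using assms jacobian_works unfolding hessian_def by blast

lemma C2_onD:
  assumes "C2_on U f" "x \<in> U"
  shows "(f has_derivative (\<lambda>h. grad f x \<bullet> h)) (at x)"
    and "(grad f has_derivative (*v) (hessian f x)) (at x)"
  using assms by (auto simp: C2_on_def has_derivative_grad has_derivative_hessian)

text \<open>Restriction to lines reduces statements about Hessians to calculus in one
  variable.\<close>

lemma C2_on_line:
  assumes "C2_on U f" "x + s *\<^sub>R v \<in> U"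
  shows "((\<lambda>s. f (x + s *\<^sub>R v)) has_real_derivative grad f (x + s *\<^sub>R v) \<bullet> v) (at s)"
    and "((\<lambda>s. grad f (x + s *\<^sub>R v) \<bullet> v) has_real_derivative
           v \<bullet> (hessian f (x + s *\<^sub>R v) *v v)) (at s)"
proof -
  have line: "((\<lambda>s. x + s *\<^sub>R v) has_derivative (\<lambda>h. h *\<^sub>R v)) (at s)"
    by (auto intro!: derivative_eq_intros)
  show "((\<lambda>s. f (x + s *\<^sub>R v)) has_real_derivative grad f (x + s *\<^sub>R v) \<bullet> v) (at s)"
    using diff_chain_at[OF line C2_onD(1)[OF assms]]
    by (simp add: o_def has_field_derivative_def mult.commute mult_commute_abs)
  have "((\<lambda>s. grad f (x + s *\<^sub>R v)) has_derivative (\<lambda>h. hessian f (x + s *\<^sub>R v) *v (h *\<^sub>R v))) (at s)"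
    using diff_chain_at[OF line C2_onD(2)[OF assms]] by (simp add: o_def)
  from has_derivative_inner_left[OF this, of v]
  show "((\<lambda>s. grad f (x + s *\<^sub>R v) \<bullet> v) has_real_derivative
           v \<bullet> (hessian f (x + s *\<^sub>R v) *v v)) (at s)"
    by (simp add: has_field_derivative_def matrix_vector_mult_scaleR inner_commute mult_commute_abs)
qed

text \<open>Mean value theorem in direction \<open>v\<close> for the first difference in direction \<open>w\<close>, followed
  by the expansion of the gradient at \<open>x\<close>.\<close>

lemma second_difference:
  fixes f :: "real^'n \<Rightarrow> real"
  assumes "C2_on U f" "open U" "x \<in> U" "\<epsilon> > 0"
  shows "\<exists>\<delta>>0. \<forall>s. 0 < s \<and> s < \<delta> \<longrightarrow>
    \<bar>f (x + s *\<^sub>R v + s *\<^sub>R w) - f (x + s *\<^sub>R v) - f (x + s *\<^sub>R w) + f x - s\<^sup>2 * (v \<bullet> (hessian f x *v w))\<bar>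
      \<le> \<epsilon> * s\<^sup>2"
proof -
  let ?H = "hessian f x"
  define N where "N = norm v + norm w + 1"
  have N: "N > 0" "norm v < N"
    by (auto simp: N_def add_nonneg_pos add_pos_nonneg intro: add_nonneg_pos)
  obtain r where r: "r > 0" "ball x r \<subseteq> U"
    using assms openE by blast
  \<comment> \<open>Each of the two gradient errors below has norm at most this tolerance times
    \<open>s * N\<close>. Together they give \<open>\<epsilon> * s / N\<close>, and pairing with
    \<open>v\<close> costs a factor at most \<open>N\<close>.\<close>
  have "0 < \<epsilon> / (2 * N\<^sup>2)"
    using N assms by simp
  then obtain d where d: "d > 0"
    "\<And>y. norm (y - x) < d \<Longrightarrow> norm (grad f y - grad f x - ?H *v (y - x)) \<le> \<epsilon> / (2 * N\<^sup>2) * norm (y - x)"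
    using C2_onD(2)[OF assms(1,3)] unfolding has_derivative_at_alt by blast
  have "\<bar>f (x + s *\<^sub>R v + s *\<^sub>R w) - f (x + s *\<^sub>R v) - f (x + s *\<^sub>R w) + f x - s\<^sup>2 * (v \<bullet> (?H *v w))\<bar>
      \<le> \<epsilon> * s\<^sup>2" if s: "0 < s" "s < min r d / N" for s
  proof -
    have sN: "s * N < r" "s * N < d"
      using s N by (auto simp: field_simps)
    have nrm: "norm (\<tau> *\<^sub>R v + \<sigma> *\<^sub>R w) \<le> s * N" if "0 \<le> \<tau>" "\<tau> \<le> s" "0 \<le> \<sigma>" "\<sigma> \<le> s" for \<tau> \<sigma>
    proof -
      have "norm (\<tau> *\<^sub>R v + \<sigma> *\<^sub>R w) \<le> \<tau> * norm v + \<sigma> * norm w"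
        using norm_triangle_ineq[of "\<tau> *\<^sub>R v" "\<sigma> *\<^sub>R w"] that by simp
      also have "\<dots> \<le> s * norm v + s * norm w"
        using that by (intro add_mono mult_right_mono) auto
      also have "\<dots> \<le> s * N"
        using s by (simp add: N_def algebra_simps)
      finally show ?thesis .
    qed
    have inU: "x + \<tau> *\<^sub>R v + \<sigma> *\<^sub>R w \<in> U" if "0 \<le> \<tau>" "\<tau> \<le> s" "0 \<le> \<sigma>" "\<sigma> \<le> s" for \<tau> \<sigma>
    proof -
      have "dist (x + (\<tau> *\<^sub>R v + \<sigma> *\<^sub>R w)) x < r"
        using nrm[OF that] sN by (simp add: dist_norm)
      then have "x + (\<tau> *\<^sub>R v + \<sigma> *\<^sub>R w) \<in> U"
        using r(2) by (auto simp: dist_commute)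
      then show ?thesis
        by (simp add: add.assoc)
    qed
    define h where "h = (\<lambda>\<tau>. f (x + s *\<^sub>R w + \<tau> *\<^sub>R v) - f (x + \<tau> *\<^sub>R v))"
    have "\<exists>z. 0 < z \<and> z < s \<and> h s - h 0 =
        (s - 0) * (grad f (x + s *\<^sub>R w + z *\<^sub>R v) \<bullet> v - grad f (x + z *\<^sub>R v) \<bullet> v)"
    proof (rule MVT2[OF s(1)])
      fix \<tau> :: real assume "0 \<le> \<tau>" "\<tau> \<le> s"
      then have "x + s *\<^sub>R w + \<tau> *\<^sub>R v \<in> U" "x + \<tau> *\<^sub>R v \<in> U"
        using inU[of \<tau> s] inU[of \<tau> 0] s by (auto simp: add_ac)
      then show "(h has_real_derivative
          grad f (x + s *\<^sub>R w + \<tau> *\<^sub>R v) \<bullet> v - grad f (x + \<tau> *\<^sub>R v) \<bullet> v) (at \<tau>)"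
        unfolding h_def by (intro DERIV_diff C2_on_line(1)[OF assms(1)])
    qed
    then obtain z where z: "0 < z" "z < s" and hz: "h s - h 0 =
        s * (grad f (x + s *\<^sub>R w + z *\<^sub>R v) \<bullet> v - grad f (x + z *\<^sub>R v) \<bullet> v)"
      by auto
    define E where "E = (\<lambda>y. grad f y - grad f x - ?H *v (y - x))"
    have E: "norm (E (x + k)) \<le> \<epsilon> / (2 * N\<^sup>2) * (s * N)" if "norm k \<le> s * N" for k
    proof -
      have "norm (E (x + k)) \<le> \<epsilon> / (2 * N\<^sup>2) * norm k"
        using d(2)[of "x + k"] that sN by (simp add: E_def)
      also have "\<dots> \<le> \<epsilon> / (2 * N\<^sup>2) * (s * N)"
        using that assms(4) N by (intro mult_left_mono) auto
      finally show ?thesis .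
    qed
    define E1 where "E1 = E (x + (z *\<^sub>R v + s *\<^sub>R w))"
    define E2 where "E2 = E (x + (z *\<^sub>R v + 0 *\<^sub>R w))"
    have "norm E1 \<le> \<epsilon> / (2 * N\<^sup>2) * (s * N)" "norm E2 \<le> \<epsilon> / (2 * N\<^sup>2) * (s * N)"
      unfolding E1_def E2_def using z s by (intro E nrm; simp)+
    then have "norm (E1 - E2) \<le> 2 * (\<epsilon> / (2 * N\<^sup>2) * (s * N))"
      using norm_triangle_ineq4[of E1 E2] by linarith
    then have EE: "norm (E1 - E2) \<le> \<epsilon> * s / N"
      using N by (simp add: field_simps power2_eq_square)
    \<comment> \<open>Both gradients are expanded at \<open>x\<close>; the contributions of the
      unknown \<open>z\<close> cancel, leaving \<open>s\<close> times the Hessian applied to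
      \<open>w\<close>.\<close>
    have "grad f (x + s *\<^sub>R w + z *\<^sub>R v) - grad f (x + z *\<^sub>R v) = s *\<^sub>R (?H *v w) + (E1 - E2)"
      by (simp add: E1_def E2_def E_def matrix_vector_right_distrib matrix_vector_mult_scaleR add_ac)
    then have G: "grad f (x + s *\<^sub>R w + z *\<^sub>R v) \<bullet> v - grad f (x + z *\<^sub>R v) \<bullet> v
        = s * (v \<bullet> (?H *v w)) + (E1 - E2) \<bullet> v"
      by (metis inner_add_left inner_commute inner_diff_left inner_scaleR_left)
    have "h s - h 0 - s\<^sup>2 * (v \<bullet> (?H *v w)) = s * ((E1 - E2) \<bullet> v)"
      unfolding hz G by (simp add: distrib_left power2_eq_square mult.assoc)
    moreover have "\<bar>(E1 - E2) \<bullet> v\<bar> \<le> \<epsilon> * s"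
    proof -
      have "\<bar>(E1 - E2) \<bullet> v\<bar> \<le> norm (E1 - E2) * norm v"
        by (rule Cauchy_Schwarz_ineq2)
      also have "\<dots> \<le> \<epsilon> * s / N * N"
        using EE N assms(4) s by (intro mult_mono) auto
      finally show ?thesis
        using N by simp
    qed
    ultimately have "\<bar>h s - h 0 - s\<^sup>2 * (v \<bullet> (?H *v w))\<bar> \<le> s * (\<epsilon> * s)"
      using s by (simp add: abs_mult)
    then show ?thesis
      by (simp add: h_def power2_eq_square algebra_simps)
  qed
  moreover have "min r d / N > 0"
    using r d N by simp
  ultimately show ?thesis
    by blast
qed

text \<open>The mixed second difference is unchanged when \<open>v\<close> and \<open>w\<close> are
  swapped, so its two limits after division by \<open>s^2\<close> agree.\<close>

lemma hessian_inner_commute: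
  fixes f :: "real^'n \<Rightarrow> real"
  assumes "C2_on U f" "open U" "x \<in> U"
  shows "v \<bullet> (hessian f x *v w) = w \<bullet> (hessian f x *v v)"
proof (rule ccontr)
  let ?a = "v \<bullet> (hessian f x *v w)" and ?b = "w \<bullet> (hessian f x *v v)"
  assume "?a \<noteq> ?b"
  \<comment> \<open>The two expansions err by at most \<open>2 * \<epsilon>\<close> in total, less
    than the supposed gap \<open>3 * \<epsilon>\<close>.\<close>
  define \<epsilon> where "\<epsilon> = \<bar>?a - ?b\<bar> / 3"
  have \<epsilon>: "\<epsilon> > 0"
    using \<open>?a \<noteq> ?b\<close> by (simp add: \<epsilon>_def)
  obtain d1 where d1: "d1 > 0" "\<And>s. 0 < s \<Longrightarrow> s < d1 \<Longrightarrow>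
     \<bar>f (x + s *\<^sub>R v + s *\<^sub>R w) - f (x + s *\<^sub>R v) - f (x + s *\<^sub>R w) + f x - s\<^sup>2 * ?a\<bar> \<le> \<epsilon> * s\<^sup>2"
    using second_difference[OF assms \<epsilon>, of v w] by blast
  obtain d2 where d2: "d2 > 0" "\<And>s. 0 < s \<Longrightarrow> s < d2 \<Longrightarrow>
     \<bar>f (x + s *\<^sub>R w + s *\<^sub>R v) - f (x + s *\<^sub>R w) - f (x + s *\<^sub>R v) + f x - s\<^sup>2 * ?b\<bar> \<le> \<epsilon> * s\<^sup>2"
    using second_difference[OF assms \<epsilon>, of w v] by blast
  define s where "s = min d1 d2 / 2"
  have s: "0 < s" "s < d1" "s < d2"
    using d1(1) d2(1) by (auto simp: s_def)
  have "x + s *\<^sub>R w + s *\<^sub>R v = x + s *\<^sub>R v + s *\<^sub>R w"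
    by simp
  then have "\<bar>s\<^sup>2 * ?a - s\<^sup>2 * ?b\<bar> \<le> 2 * (\<epsilon> * s\<^sup>2)"
    using d1(2)[of s] d2(2)[of s] s by (smt (verit))
  then have "s\<^sup>2 * \<bar>?a - ?b\<bar> \<le> s\<^sup>2 * (2 * \<epsilon>)"
    by (simp add: right_diff_distrib[symmetric] abs_mult mult_ac)
  then have "\<bar>?a - ?b\<bar> \<le> 2 * \<epsilon>"
    using s by simp
  then show False
    using \<epsilon> by (simp add: \<epsilon>_def)
qed

lemma transpose_eq_selfI:
  fixes A :: "real^'n^'n"
  assumes "\<And>v w. v \<bullet> (A *v w) = w \<bullet> (A *v v)"
  shows "transpose A = A"
proof -
  have "axis i 1 \<bullet> (A *v axis j 1) = A $ i $ j" for i j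
    by (simp add: inner_axis' matrix_vector_mult_basis column_def)
  then have "A $ i $ j = A $ j $ i" for i j
    using assms[of "axis i 1" "axis j 1"] by simp
  then show ?thesis
    by (simp add: transpose_def vec_eq_iff)
qed

lemma transpose_hessian:
  assumes "C2_on U f" "open U" "x \<in> U"
  shows "transpose (hessian f x) = hessian f x"
  using hessian_inner_commute[OF assms] by (rule transpose_eq_selfI)

section \<open>Second-order conditions from symmetric second differences\<close>

text \<open>The function \<open>h' s - h' (- s)\<close> vanishes at 0 with derivative
  \<open>2 * D\<close>. If \<open>D\<close> were negative, it would be negative for small positive
  \<open>s\<close>, and the mean value theorem would push \<open>h s + h (- s)\<close> below
  \<open>2 * h 0\<close>.\<close>

lemma symmetric_second_difference_nonneg:
  fixes h h' :: "real \<Rightarrow> real"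
  assumes "\<delta> > 0" and h: "\<And>s. \<bar>s\<bar> < \<delta> \<Longrightarrow> (h has_real_derivative h' s) (at s)"
    and h': "(h' has_real_derivative D) (at 0)"
    and ge: "\<And>s. \<bar>s\<bar> < \<delta> \<Longrightarrow> 2 * h 0 \<le> h s + h (- s)"
  shows "0 \<le> D"
proof (rule ccontr)
  assume "\<not> 0 \<le> D"
  have "((\<lambda>s. h' (- s)) has_real_derivative - D) (at 0)"
    using h' DERIV_mirror[of h' D 0] by simp
  then have "((\<lambda>s. h' s - h' (- s)) has_real_derivative D - (- D)) (at 0)"
    by (intro DERIV_diff h')
  moreover have "D - (- D) < 0"
    using \<open>\<not> 0 \<le> D\<close> by simp
  ultimately obtain d where "d > 0" "\<forall>s>0. s < d \<longrightarrow> h' 0 - h' (- 0) > h' (0 + s) - h' (- (0 + s))"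
    by (blast dest: DERIV_neg_dec_right)
  then have d: "d > 0" "\<And>s. 0 < s \<Longrightarrow> s < d \<Longrightarrow> h' s - h' (- s) < 0"
    by simp_all
  define t where "t = min d \<delta> / 2"
  have t: "0 < t" "t < d" "t < \<delta>"
    using d(1) assms(1) by (auto simp: t_def)
  have "\<exists>z. 0 < z \<and> z < t \<and>
      (h t + h (- t)) - (h 0 + h (- 0)) = (t - 0) * (h' z - h' (- z))"
  proof (rule MVT2[OF t(1)])
    fix s assume "0 \<le> s" "s \<le> t"
    then have s: "\<bar>s\<bar> < \<delta>" "\<bar>- s\<bar> < \<delta>"
      using t by auto
    have "((\<lambda>s. h (- s)) has_real_derivative - h' (- s)) (at s)"
      using h[OF s(2)] DERIV_mirror by blast
    from DERIV_add[OF h[OF s(1)] this]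
    show "((\<lambda>s. h s + h (- s)) has_real_derivative h' s - h' (- s)) (at s)"
      by simp
  qed
  then obtain z where z: "0 < z" "z < t" "h t + h (- t) - 2 * h 0 = t * (h' z - h' (- z))"
    by auto
  have "t * (h' z - h' (- z)) < 0"
    using d(2)[of z] z t by (simp add: mult_less_0_iff)
  then show False
    using z(3) ge[of t] t by simp
qed

lemma line_in_open:
  fixes x v :: "'a::real_normed_vector"
  assumes "open U" "x \<in> U"
  obtains \<delta> where "\<delta> > 0" "\<And>s. \<bar>s\<bar> < \<delta> \<Longrightarrow> x + s *\<^sub>R v \<in> U"
proof -
  obtain r where r: "r > 0" "ball x r \<subseteq> U"
    using assms openE by blast
  show ?thesis
  proof
    show "r / (norm v + 1) > 0"
      using r by (simp add: add_nonneg_pos)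
    show "x + s *\<^sub>R v \<in> U" if "\<bar>s\<bar> < r / (norm v + 1)" for s
    proof -
      have "\<bar>s\<bar> * (norm v + 1) < r"
        using that by (simp add: pos_less_divide_eq add_nonneg_pos)
      then have "dist x (x + s *\<^sub>R v) < r"
        by (simp add: dist_norm distrib_left)
      then show ?thesis
        using r(2) by auto
    qed
  qed
qed

text \<open>Midpoint convexity on each line through \<open>x\<close> is the required second
  difference inequality.\<close>

lemma pos_semidef_hessian_convex:
  assumes "C2_on U f" "open U" "x \<in> U" "convex_on U f"
  shows "pos_semidef (hessian f x)"
  unfolding pos_semidef_def
proof (intro conjI allI)
  show "transpose (hessian f x) = hessian f x"
    using assms(1-3) by (rule transpose_hessian)
  fix v
  obtain \<delta> where \<delta>: "\<delta> > 0" "\<And>s. \<bar>s\<bar> < \<delta> \<Longrightarrow> x + s *\<^sub>R v \<in> U"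
    using line_in_open[OF assms(2,3)] by metis
  show "0 \<le> v \<bullet> (hessian f x *v v)"
  proof (rule symmetric_second_difference_nonneg[OF \<delta>(1)])
    show "((\<lambda>s. f (x + s *\<^sub>R v)) has_real_derivative grad f (x + s *\<^sub>R v) \<bullet> v) (at s)"
      if "\<bar>s\<bar> < \<delta>" for s
      using C2_on_line(1)[OF assms(1) \<delta>(2)[OF that]] .
    show "((\<lambda>s. grad f (x + s *\<^sub>R v) \<bullet> v) has_real_derivative v \<bullet> (hessian f x *v v)) (at 0)"
      using C2_on_line(2)[OF assms(1), of x 0 v] assms(3) by simp
    show "2 * f (x + 0 *\<^sub>R v) \<le> f (x + s *\<^sub>R v) + f (x + (- s) *\<^sub>R v)" if "\<bar>s\<bar> < \<delta>" for s
    proof -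
      have "f ((1/2) *\<^sub>R (x + s *\<^sub>R v) + (1/2) *\<^sub>R (x + (- s) *\<^sub>R v))
          \<le> 1/2 * f (x + s *\<^sub>R v) + 1/2 * f (x + (- s) *\<^sub>R v)"
        using convex_onD[OF assms(4), of "1/2" "x + s *\<^sub>R v" "x + (- s) *\<^sub>R v"]
          \<delta>(2)[of s] \<delta>(2)[of "- s"] that by simp
      moreover have "(1/2) *\<^sub>R (x + s *\<^sub>R v) + (1/2) *\<^sub>R (x + (- s) *\<^sub>R v) = x"
        by (simp add: vec_eq_iff field_simps)
      ultimately show ?thesis
        by simp
    qed
  qed
qed

text \<open>The second-order necessary condition at a minimum: adding the minimality inequalities at
  two opposite points bounds the second difference from below.\<close>

lemma pos_semidef_hessian_diff:
  assumes "C2_on U f" "C2_on U g" "open U" "x \<in> U"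
    and min: "\<And>y. y \<in> U \<Longrightarrow> f x - g x \<le> f y - g y"
  shows "pos_semidef (hessian f x - hessian g x)"
  unfolding pos_semidef_def
proof (intro conjI allI)
  show "transpose (hessian f x - hessian g x) = hessian f x - hessian g x"
    using transpose_hessian[OF assms(1,3,4)] transpose_hessian[OF assms(2,3,4)]
    by (simp add: transpose_def vec_eq_iff)
  fix v
  obtain \<delta> where \<delta>: "\<delta> > 0" "\<And>s. \<bar>s\<bar> < \<delta> \<Longrightarrow> x + s *\<^sub>R v \<in> U"
    using line_in_open[OF assms(3,4)] by metis
  have "0 \<le> v \<bullet> (hessian f x *v v) - v \<bullet> (hessian g x *v v)"
  proof (rule symmetric_second_difference_nonneg[OF \<delta>(1)])
    show "((\<lambda>s. f (x + s *\<^sub>R v) - g (x + s *\<^sub>R v)) has_real_derivative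
        grad f (x + s *\<^sub>R v) \<bullet> v - grad g (x + s *\<^sub>R v) \<bullet> v) (at s)" if "\<bar>s\<bar> < \<delta>" for s
      using C2_on_line(1)[OF assms(1) \<delta>(2)[OF that]] C2_on_line(1)[OF assms(2) \<delta>(2)[OF that]]
      by (rule DERIV_diff)
    show "((\<lambda>s. grad f (x + s *\<^sub>R v) \<bullet> v - grad g (x + s *\<^sub>R v) \<bullet> v) has_real_derivative
        v \<bullet> (hessian f x *v v) - v \<bullet> (hessian g x *v v)) (at 0)"
      using C2_on_line(2)[OF assms(1), of x 0 v] C2_on_line(2)[OF assms(2), of x 0 v] assms(4)
      by (intro DERIV_diff) simp_all
    show "2 * (f (x + 0 *\<^sub>R v) - g (x + 0 *\<^sub>R v))
        \<le> f (x + s *\<^sub>R v) - g (x + s *\<^sub>R v) + (f (x + (- s) *\<^sub>R v) - g (x + (- s) *\<^sub>R v))"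
      if "\<bar>s\<bar> < \<delta>" for s
      using min[OF \<delta>(2)[of s]] min[OF \<delta>(2)[of "- s"]] that by simp
  qed
  then show "0 \<le> v \<bullet> ((hessian f x - hessian g x) *v v)"
    by (simp add: matrix_vector_mult_diff_rdistrib inner_diff_right)
qed

section \<open>Classical solutions as viscosity subsolutions\<close>

lemma C2_on_subset: "C2_on U f \<Longrightarrow> V \<subseteq> U \<Longrightarrow> C2_on V f"
  unfolding C2_on_def by (auto intro: continuous_on_subset)

text \<open>Touching from above orders the Hessians of \<open>\<psi>\<close> and \<open>u\<close>,
  convexity makes both positive semi-definite, and monotonicity of \<open>F\<close> transfers the
  equation to an inequality for \<open>\<psi>\<close>.\<close>

lemma classical_solution_imp_viscosity_subsolution:
  assumes mono: "\<And>A B. pos_semidef A \<Longrightarrow> pos_semidef B \<Longrightarrow> pos_semidef (A - B) \<Longrightarrow>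
      F (eigenvalue_vec A) \<ge> F (eigenvalue_vec B)"
    and u: "classical_solution F f \<Omega> \<phi> u"
  shows "viscosity_subsolution F f \<Omega> u"
  unfolding viscosity_subsolution_def
proof (intro conjI ballI allI impI)
  show conv: "convex_on (closure \<Omega>) u" and "continuous_on (closure \<Omega>) u"
    using u by (auto simp: classical_solution_def)
  fix x U \<psi>
  assume x: "x \<in> \<Omega>"
    and "open U \<and> x \<in> U \<and> U \<subseteq> \<Omega> \<and> convex_on U \<psi> \<and> C2_on U \<psi> \<and> (\<forall>y\<in>U. \<psi> x - u x \<le> \<psi> y - u y)"
  then have U: "open U" "x \<in> U" "U \<subseteq> \<Omega>" "convex_on U \<psi>" "C2_on U \<psi>"
    and min: "\<And>y. y \<in> U \<Longrightarrow> \<psi> x - u x \<le> \<psi> y - u y"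
    by auto
  have u_C2: "C2_on U u"
    using u U(3) by (auto simp: classical_solution_def intro: C2_on_subset)
  \<comment> \<open>\<open>convex_on U \<psi>\<close> contains the convexity of \<open>U\<close>, so
    \<open>u\<close> can be restricted to it.\<close>
  have "convex_on U u"
    using conv U(3,4) closure_subset[of \<Omega>] by (metis convex_on_imp_convex convex_on_subset subset_trans)
  have "f x = F (eigenvalue_vec (hessian u x))"
    using u x by (simp add: classical_solution_def)
  also have "\<dots> \<le> F (eigenvalue_vec (hessian \<psi> x))"
    using U u_C2 \<open>convex_on U u\<close> min
    by (intro mono) (auto intro: pos_semidef_hessian_convex pos_semidef_hessian_diff)
  finally show "f x \<le> F (eigenvalue_vec (hessian \<psi> x))" .
qed

section \<open>Geometry of the domain at a boundary point\<close>

text \<open>The domain cannot lie on both sides of its boundary, as it would at a slit: otherwise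
  \<open>\<rho>\<close> would be at most 0 around \<open>p\<close> and at least 0 at
  \<open>p\<close>, a local maximum with nonzero gradient. This allows a supporting hyperplane at
  \<open>p\<close>.\<close>

lemma C2_domain_frontier_notin_interior_closure:
  assumes "C2_domain \<Omega>" "p \<in> frontier \<Omega>"
  shows "p \<notin> interior (closure \<Omega>)"
proof
  assume p: "p \<in> interior (closure \<Omega>)"
  obtain U \<rho> where U: "open U" "p \<in> U" "C2_on U \<rho>" "grad \<rho> p \<noteq> 0" "\<Omega> \<inter> U = {x \<in> U. \<rho> x < 0}"
    using assms unfolding C2_domain_def C2_defining_function_def by blast
  have "open \<Omega>"
    using assms(1) by (simp add: C2_domain_def)
  have cont: "continuous_on U \<rho>"
    using U(3) by (auto simp: C2_on_def intro!: continuous_at_imp_continuous_on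
        differentiable_imp_continuous_within)
  have le0: "\<rho> x \<le> 0" if "x \<in> U" "x \<in> closure \<Omega>" for x
  proof (rule ccontr)
    assume "\<not> \<rho> x \<le> 0"
    define V where "V = U \<inter> \<rho> -` {0<..}"
    have "open V"
      unfolding V_def using cont U(1) by (simp add: continuous_on_open_vimage Int_commute)
    moreover have "x \<in> V"
      using that \<open>\<not> \<rho> x \<le> 0\<close> by (simp add: V_def)
    moreover have "V \<inter> \<Omega> = {}"
    proof -
      have "\<rho> y < 0" if "y \<in> U" "y \<in> \<Omega>" for y
        using U(5) that by blast
      then show ?thesis
        by (force simp: V_def)
    qed
    ultimately show False
      using that(2) by (metis Int_iff empty_iff open_Int_closure_eq_empty)
  qed
  have "p \<notin> \<Omega>"
    using assms(2) \<open>open \<Omega>\<close> by (simp add: frontier_def interior_open)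
  then have "\<rho> p \<ge> 0"
    using U(2,5) by force
  have D: "(\<rho> has_derivative frechet_derivative \<rho> (at p)) (at p)"
    using U(2,3) by (simp add: C2_on_def frechet_derivative_works)
  have "frechet_derivative \<rho> (at p) = (\<lambda>v. 0)"
  proof (rule differential_zero_maxmin[OF _ _ D])
    show "p \<in> U \<inter> interior (closure \<Omega>)" "open (U \<inter> interior (closure \<Omega>))"
      using p U(1,2) by auto
    show "(\<forall>y\<in>U \<inter> interior (closure \<Omega>). \<rho> y \<le> \<rho> p) \<or> (\<forall>y\<in>U \<inter> interior (closure \<Omega>). \<rho> p \<le> \<rho> y)"
      using le0 \<open>\<rho> p \<ge> 0\<close> interior_subset[of "closure \<Omega>"] by (meson IntE order_trans subsetD)
  qed
  then show False
    using U(4) by (simp add: grad_def zero_vec_def)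
qed

text \<open>The supporting half-space at a nearest boundary point \<open>p\<close> of some interior point is tangent
  to the interior ball, so both share the outer normal \<open>e\<close>.\<close>

lemma interior_ball_and_halfspace:
  assumes "C2_domain \<Omega>" "frontier \<Omega> \<noteq> {}" "convex (closure \<Omega>)"
  obtains p e R where "p \<in> frontier \<Omega>" "norm e = 1" "R > 0" "ball (p - R *\<^sub>R e) R \<subseteq> \<Omega>"
    "\<And>y. y \<in> closure \<Omega> \<Longrightarrow> e \<bullet> y \<le> e \<bullet> p"
proof -
  have "open \<Omega>" "\<Omega> \<noteq> {}"
    using assms(1) by (auto simp: C2_domain_def)
  then obtain c where c: "c \<in> \<Omega>"
    by blast
  obtain p where p: "p \<in> frontier \<Omega>" "infdist c (frontier \<Omega>) = dist c p"
    using infdist_attains_inf[of "frontier \<Omega>" c] assms(2) by auto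
  define R where "R = dist c p"
  have "c \<notin> frontier \<Omega>"
    using c \<open>open \<Omega>\<close> by (simp add: frontier_def interior_open)
  then have R: "R > 0"
    using p(1) by (auto simp: R_def)
  have ball: "ball c R \<subseteq> \<Omega>"
  proof (rule ccontr)
    assume "\<not> ball c R \<subseteq> \<Omega>"
    moreover have "ball c R \<inter> \<Omega> \<noteq> {}"
      using c R by (metis IntI centre_in_ball empty_iff)
    \<comment> \<open>A ball that meets \<open>\<Omega>\<close> without lying inside it meets the
      frontier, at a point nearer to \<open>c\<close> than \<open>p\<close>.\<close>
    ultimately have "ball c R \<inter> frontier \<Omega> \<noteq> {}"
      by (intro connected_Int_frontier) (auto simp del: disjoint_iff)
    then show False
      using infdist_le[of _ "frontier \<Omega>" c] p(2) by (force simp: R_def)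
  qed
  have "interior (closure \<Omega>) \<noteq> {}"
    using c \<open>open \<Omega>\<close> closure_subset interior_maximal by blast
  then have "p \<notin> rel_interior (closure \<Omega>)"
    using C2_domain_frontier_notin_interior_closure[OF assms(1) p(1)]
    by (simp add: rel_interior_nonempty_interior)
  moreover have "p \<in> closure \<Omega>"
    using p(1) by (simp add: frontier_def)
  ultimately obtain h where h: "h \<noteq> 0" "\<And>y. y \<in> closure \<Omega> \<Longrightarrow> h \<bullet> p \<le> h \<bullet> y"
    using supporting_hyperplane_rel_boundary[OF assms(3)] by metis
  \<comment> \<open>The functional \<open>h\<close> is smallest at \<open>p\<close>, so its sign is
    flipped to make \<open>e\<close> point outwards.\<close>
  define e where "e = - (h /\<^sub>R norm h)"
  have e: "norm e = 1"
    using h(1) by (simp add: e_def)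
  have half: "e \<bullet> y \<le> e \<bullet> p" if "y \<in> closure \<Omega>" for y
    using h(2)[OF that] h(1) by (simp add: e_def divide_simps)
  \<comment> \<open>The closed ball stays in the half-space, so its extreme point
    \<open>c + R e\<close> gives \<open>R \<le> e \<bullet> (p - c)\<close>. As \<open>p - c\<close>
    has norm \<open>R\<close>, equality holds in Cauchy-Schwarz and \<open>p - c\<close> is
    \<open>R e\<close>.\<close>
  have "closure (ball c R) \<subseteq> closure \<Omega>"
    using ball by (rule closure_mono)
  moreover have "c + R *\<^sub>R e \<in> cball c R"
    using R e by (simp add: dist_norm)
  ultimately have "e \<bullet> (c + R *\<^sub>R e) \<le> e \<bullet> p"
    using R by (intro half) auto
  moreover have "e \<bullet> e = 1"
    using e by (simp add: norm_eq_1)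
  ultimately have "R \<le> e \<bullet> (p - c)"
    by (simp add: inner_right_distrib inner_diff_right)
  moreover have Rn: "norm (p - c) = R"
    by (simp add: R_def dist_norm norm_minus_commute)
  ultimately have "e \<bullet> (p - c) = norm e * norm (p - c)"
    using norm_cauchy_schwarz[of e "p - c"] e by simp
  then have "p - c = R *\<^sub>R e"
    using norm_cauchy_schwarz_eq[of e "p - c"] e Rn by simp
  then have "c = p - R *\<^sub>R e"
    by (simp add: algebra_simps)
  with that[OF p(1) e R] ball half show ?thesis
    by blast
qed

text \<open>A walk from \<open>x\<close> in direction \<open>e\<close> must cross the frontier
  before passing the hyperplane by any positive \<open>d\<close>; going strictly beyond it
  guarantees an endpoint outside \<open>\<Omega>\<close>.\<close>

lemma infdist_frontier_le_halfspace:
  fixes x :: "'a::euclidean_space"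
  assumes "x \<in> \<Omega>" "norm e = 1" and half: "\<And>y. y \<in> closure \<Omega> \<Longrightarrow> e \<bullet> y \<le> \<kappa>"
  shows "infdist x (frontier \<Omega>) \<le> \<kappa> - e \<bullet> x"
proof (rule field_le_epsilon)
  fix d :: real assume "d > 0"
  define z where "z = x + (\<kappa> - e \<bullet> x + d) *\<^sub>R e"
  have "e \<bullet> e = 1"
    using assms(2) by (simp add: norm_eq_1)
  then have "e \<bullet> z = \<kappa> + d"
    by (simp add: z_def inner_right_distrib)
  then have "z \<notin> \<Omega>"
    using half[of z] closure_subset[of \<Omega>] \<open>d > 0\<close> by auto
  then have "closed_segment x z \<inter> frontier \<Omega> \<noteq> {}"
    using assms(1) by (intro connected_Int_frontier) auto
  then obtain q where q: "q \<in> closed_segment x z" "q \<in> frontier \<Omega>"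
    by blast
  have "0 \<le> \<kappa> - e \<bullet> x"
    using half[of x] assms(1) closure_subset[of \<Omega>] by auto
  then have "dist x z = \<kappa> - e \<bullet> x + d"
    using assms(2) \<open>d > 0\<close> by (simp add: z_def dist_norm)
  moreover have "dist x q \<le> dist x z"
    using q(1) segment_bound(1)[of q x z] by (simp add: dist_norm norm_minus_commute)
  ultimately show "infdist x (frontier \<Omega>) \<le> \<kappa> - e \<bullet> x + d"
    using infdist_le[OF q(2), of x] by linarith
qed

section \<open>Quadratic barriers\<close>

text \<open>Division by 2 makes a symmetric \<open>A\<close> the Hessian itself.\<close>

definition quad :: "real^'n^'n \<Rightarrow> real^'n \<Rightarrow> real^'n \<Rightarrow> real" where
  "quad A c y = ((y - c) \<bullet> (A *v (y - c))) / 2"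

lemma symmetric_inner_commute:
  fixes A :: "real^'n^'n"
  assumes "transpose A = A"
  shows "v \<bullet> (A *v w) = w \<bullet> (A *v v)"
  using dot_lmul_matrix[of v A w] vector_transpose_matrix[of v A] assms by (simp add: inner_commute)

lemma has_derivative_matrix_vector:
  fixes A :: "real^'n^'n"
  shows "((\<lambda>y. A *v (y - c)) has_derivative (*v) A) (at y)"
proof -
  have "((\<lambda>y. y - c) has_derivative (\<lambda>h. h)) (at y)"
    by (auto intro!: derivative_eq_intros)
  then show ?thesis
    by (rule bounded_linear.has_derivative[OF matrix_vector_mul_bounded_linear])
qed

lemma has_derivative_quad:
  fixes A :: "real^'n^'n"
  assumes "transpose A = A"
  shows "(quad A c has_derivative (\<lambda>h. (A *v (y - c)) \<bullet> h)) (at y)"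
proof -
  note sym = symmetric_inner_commute[OF assms]
  have "((\<lambda>y. ((y - c) \<bullet> (A *v (y - c))) / 2) has_derivative
      (\<lambda>h. ((y - c) \<bullet> (A *v h) + h \<bullet> (A *v (y - c))) / 2)) (at y)"
    by (rule derivative_eq_intros refl has_derivative_matrix_vector)+ (auto simp: fun_eq_iff)
  then show ?thesis
    unfolding quad_def[abs_def] by (simp add: sym[of "y - c"] inner_commute[of _ "A *v (y - c)"])
qed

lemma
  fixes A :: "real^'n^'n"
  assumes "transpose A = A"
  shows hessian_quad: "hessian (quad A c) y = A" and C2_on_quad: "C2_on U (quad A c)"
proof -
  have grad: "grad (quad A c) = (\<lambda>y. A *v (y - c))"
    using grad_eqI[OF has_derivative_quad[OF assms]] by blast
  have der: "(grad (quad A c) has_derivative (*v) A) (at y)" for y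
    unfolding grad by (rule has_derivative_matrix_vector)
  show hess: "hessian (quad A c) y = A" for y
    using der by (rule hessian_eqI)
  show "C2_on U (quad A c)"
    unfolding C2_on_def using has_derivative_quad[OF assms] der
    by (auto simp: differentiable_def hess cong: continuous_on_cong)
qed

text \<open>Since \<open>r + s = 1\<close>, twice the convexity gap is \<open>r * s\<close> times
  the quadratic form of \<open>A\<close> at \<open>v - w\<close>.\<close>

lemma convex_on_quad:
  fixes A :: "real^'n^'n"
  assumes "pos_semidef A" "convex U"
  shows "convex_on U (quad A c)"
  unfolding convex_on_def
proof (intro conjI assms(2) ballI allI impI)
  fix x y :: "real^'n" and r s :: real
  assume "0 \<le> r" "0 \<le> s" and rs: "r + s = 1"
  have "transpose A = A"
    using assms(1) by (simp add: pos_semidef_def)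
  note sym = symmetric_inner_commute[OF this]
  define v w where "v = x - c" and "w = y - c"
  have z: "r *\<^sub>R x + s *\<^sub>R y - c = r *\<^sub>R v + s *\<^sub>R w"
    using rs by (simp add: v_def w_def algebra_simps flip: scaleR_add_left)
  have "0 \<le> r * s * ((v - w) \<bullet> (A *v (v - w)))"
    using assms(1) \<open>0 \<le> r\<close> \<open>0 \<le> s\<close> by (simp add: pos_semidef_def)
  also have "\<dots> = r * s * (v \<bullet> (A *v v) + w \<bullet> (A *v w) - 2 * (v \<bullet> (A *v w)))"
    by (simp add: matrix_vector_mult_diff_distrib inner_diff_left inner_diff_right sym[of w v])
  also have "\<dots> = r * (v \<bullet> (A *v v)) + s * (w \<bullet> (A *v w))
      - (r * r * (v \<bullet> (A *v v)) + s * s * (w \<bullet> (A *v w)) + 2 * r * s * (v \<bullet> (A *v w)))"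
    using rs by algebra
  also have "\<dots> = r * (v \<bullet> (A *v v)) + s * (w \<bullet> (A *v w))
      - (r *\<^sub>R v + s *\<^sub>R w) \<bullet> (A *v (r *\<^sub>R v + s *\<^sub>R w))"
    by (simp add: matrix_vector_right_distrib matrix_vector_mult_scaleR inner_add_left
        inner_add_right sym[of w v] algebra_simps)
  finally show "quad A c (r *\<^sub>R x + s *\<^sub>R y) \<le> r * quad A c x + s * quad A c y"
    unfolding quad_def z by (simp add: v_def w_def)
qed

lemma quad_stretch: "quad (stretch \<mu> \<beta> e) c y = (\<mu> * (norm (y - c))\<^sup>2 + \<beta> * (e \<bullet> (y - c))\<^sup>2) / 2"
  by (simp add: quad_def inner_stretch)

section \<open>Touching a subsolution from above\<close>

text \<open>On the edge of the ellipsoid the paraboloid has risen by \<open>\<epsilon>\<close>, more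
  than \<open>u\<close> can vary, so the minimum of paraboloid minus \<open>u\<close> is attained
  inside. There the paraboloid is an admissible test function.\<close>

lemma subsolution_touched_by_quad:
  assumes u: "viscosity_subsolution F f \<Omega> u" and "open \<Omega>" and "0 < \<mu>" "0 \<le> \<beta>" "0 < \<epsilon>"
    and E: "{y. quad (stretch \<mu> \<beta> e) c y \<le> \<epsilon>} \<subseteq> \<Omega>"
    and osc: "\<And>y. quad (stretch \<mu> \<beta> e) c y \<le> \<epsilon> \<Longrightarrow> \<bar>u y - u c\<bar> < \<epsilon>"
  obtains x where "quad (stretch \<mu> \<beta> e) c x < \<epsilon>" "f x \<le> F (eigenvalue_vec (stretch \<mu> \<beta> e))"
proof -
  let ?A = "stretch \<mu> \<beta> e"
  let ?E = "{y. quad ?A c y \<le> \<epsilon>}"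
  have psd: "pos_semidef ?A"
    using assms(3,4) by (simp add: pos_semidef_stretch)
  then have tr: "transpose ?A = ?A"
    by (simp add: transpose_stretch)
  have cont: "continuous_on S (quad ?A c)" for S
    unfolding quad_stretch by (intro continuous_intros) simp
  have "?E \<subseteq> cball c (sqrt (2 * \<epsilon> / \<mu>))"
  proof
    fix y assume "y \<in> ?E"
    then have "\<mu> * (norm (y - c))\<^sup>2 + \<beta> * (e \<bullet> (y - c))\<^sup>2 \<le> 2 * \<epsilon>"
      by (simp add: quad_stretch)
    moreover have "0 \<le> \<beta> * (e \<bullet> (y - c))\<^sup>2"
      using assms(4) by simp
    ultimately have "(norm (y - c))\<^sup>2 \<le> 2 * \<epsilon> / \<mu>"
      using assms(3) by (simp add: field_simps)
    then show "y \<in> cball c (sqrt (2 * \<epsilon> / \<mu>))"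
      by (simp add: dist_norm norm_minus_commute real_le_rsqrt)
  qed
  moreover have "closed ?E"
    by (intro closed_Collect_le cont continuous_on_const)
  ultimately have "compact ?E"
    by (meson bounded_cball bounded_subset compact_eq_bounded_closed)
  moreover have c: "quad ?A c c = 0"
    by (simp add: quad_def)
  then have "c \<in> ?E"
    using assms(5) by simp
  then have "?E \<noteq> {}"
    by blast
  moreover have "continuous_on (closure \<Omega>) u"
    using u by (simp add: viscosity_subsolution_def)
  then have "continuous_on ?E (\<lambda>y. quad ?A c y - u y)"
    using E closure_subset[of \<Omega>] by (intro continuous_intros cont) (auto intro: continuous_on_subset)
  ultimately obtain x where x: "x \<in> ?E" "\<And>y. y \<in> ?E \<Longrightarrow> quad ?A c x - u x \<le> quad ?A c y - u y"
    using continuous_attains_inf[of ?E "\<lambda>y. quad ?A c y - u y"] by auto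
  \<comment> \<open>Comparison with the centre gives \<open>quad ?A c x \<le> u x - u c\<close>,
    which is below \<open>\<epsilon>\<close>.\<close>
  have "quad ?A c x - u x \<le> - u c"
    using x(2)[of c] c assms(5) by simp
  then have lt: "quad ?A c x < \<epsilon>"
    using osc[of x] x(1) by auto
  have "open {y. quad ?A c y < \<epsilon>}"
    by (intro open_Collect_less cont continuous_on_const)
  then obtain r where r: "r > 0" "ball x r \<subseteq> {y. quad ?A c y < \<epsilon>}"
    using lt openE by blast
  then have sub: "ball x r \<subseteq> ?E"
    by auto
  have "f x \<le> F (eigenvalue_vec (hessian (quad ?A c) x))"
  proof -
    have "open (ball x r) \<and> x \<in> ball x r \<and> ball x r \<subseteq> \<Omega> \<and> convex_on (ball x r) (quad ?A c) \<and>
        C2_on (ball x r) (quad ?A c) \<and> (\<forall>y\<in>ball x r. quad ?A c x - u x \<le> quad ?A c y - u y)"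
      using r sub E x(2) by (auto intro: convex_on_quad[OF psd] C2_on_quad[OF tr])
    moreover have "x \<in> \<Omega>"
      using x(1) E by blast
    ultimately show ?thesis
      using u unfolding viscosity_subsolution_def by blast
  qed
  then show ?thesis
    using that lt by (simp add: hessian_quad[OF tr])
qed

section \<open>Non-existence\<close>

text \<open>The coefficient \<open>32\<close> keeps the ellipsoid at depths between \<open>3t/4\<close> and \<open>5t/4\<close>, and \<open>8 / R\<close>
  makes its tangential axis short enough to fit into an interior ball of radius \<open>R\<close>.\<close>

lemma barrier_region:
  assumes "0 < t" "0 < R" "0 < \<epsilon>"
    and "quad (stretch (8 / R * \<epsilon> / t) (32 * \<epsilon> / t\<^sup>2) e) c y \<le> \<epsilon>"
  shows "(norm (y - c))\<^sup>2 \<le> t * R / 4" "\<bar>e \<bullet> (y - c)\<bar> \<le> t / 4"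
proof -
  \<comment> \<open>All coefficients are proportional to \<open>\<epsilon>\<close>, so it cancels:
    the shape of the ellipsoid depends only on \<open>t\<close> and \<open>R\<close>.\<close>
  have "\<epsilon> * (8 / R / t * (norm (y - c))\<^sup>2 + 32 / t\<^sup>2 * (e \<bullet> (y - c))\<^sup>2) \<le> \<epsilon> * 2"
    using assms(4) by (simp add: quad_stretch distrib_left mult_ac)
  then have sum: "8 / R / t * (norm (y - c))\<^sup>2 + 32 / t\<^sup>2 * (e \<bullet> (y - c))\<^sup>2 \<le> 2"
    using assms(3) by simp
  moreover have "0 \<le> 8 / R / t * (norm (y - c))\<^sup>2" "0 \<le> 32 / t\<^sup>2 * (e \<bullet> (y - c))\<^sup>2"
    using assms by simp_all
  ultimately have le: "8 / R / t * (norm (y - c))\<^sup>2 \<le> 2" "32 / t\<^sup>2 * (e \<bullet> (y - c))\<^sup>2 \<le> 2"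
    by linarith+
  show "(norm (y - c))\<^sup>2 \<le> t * R / 4"
    using le(1) assms by (simp add: field_simps)
  have "(e \<bullet> (y - c))\<^sup>2 \<le> (t / 4)\<^sup>2"
    using le(2) assms by (simp add: field_simps power2_eq_square)
  then show "\<bar>e \<bullet> (y - c)\<bar> \<le> t / 4"
    using assms(1) by (simp add: abs_le_square_iff[symmetric])
qed

text \<open>The point \<open>p - t e\<close> is at distance \<open>R - t\<close> from the centre of
  the ball, along \<open>e\<close>. Expanding the square leaves the slack
  \<open>3 * t * R / 4 + t * (R - t) / 2\<close>, which is positive.\<close>

lemma barrier_in_ball:
  fixes p e y :: "'a::euclidean_space"
  assumes "norm e = 1" "0 < t" "t \<le> R"
    and y: "(norm (y - (p - t *\<^sub>R e)))\<^sup>2 \<le> t * R / 4" "\<bar>e \<bullet> (y - (p - t *\<^sub>R e))\<bar> \<le> t / 4"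
  shows "y \<in> ball (p - R *\<^sub>R e) R"
proof -
  define z where "z = y - (p - t *\<^sub>R e)"
  have ee: "e \<bullet> e = 1"
    using assms(1) by (simp add: norm_eq_1)
  have "y - (p - R *\<^sub>R e) = z + (R - t) *\<^sub>R e"
    by (simp add: z_def algebra_simps)
  then have "(norm (y - (p - R *\<^sub>R e)))\<^sup>2 = (norm z)\<^sup>2 + 2 * ((R - t) * (e \<bullet> z)) + (R - t)\<^sup>2"
    unfolding power2_norm_eq_inner
    by (simp add: inner_add_left inner_add_right ee inner_commute power2_eq_square)
  also have "\<dots> \<le> t * R / 4 + 2 * ((R - t) * (t / 4)) + (R - t)\<^sup>2"
    using y assms(3) by (intro add_mono mult_left_mono) (auto simp: z_def)
  also have "\<dots> = R\<^sup>2 - t * R * 3 / 4 - t * (R - t) / 2"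
    by (simp add: field_simps power2_eq_square)
  also have "\<dots> < R\<^sup>2"
  proof -
    have "0 < t * R" "0 \<le> t * (R - t)"
      using assms(2,3) by auto
    then show ?thesis
      by linarith
  qed
  finally have "norm (y - (p - R *\<^sub>R e)) < R"
    using assms(2,3) by (simp add: power2_less_imp_less)
  then show ?thesis
    by (simp add: dist_norm norm_minus_commute)
qed

text \<open>The steep eigenvalue scales like \<open>1 / t^2\<close> and the flat one like
  \<open>1 / t\<close>, which produces the critical exponent \<open>- a - 2 * b\<close>.\<close>

lemma barrier_powers:
  fixes t :: real
  assumes "0 < t" "0 < \<epsilon>" "0 < L" "0 < M"
  shows "(L * \<epsilon> / t) powr a * (M * \<epsilon> / t\<^sup>2) powr b
    = L powr a * M powr b * \<epsilon> powr (a + b) * t powr (- a - 2 * b)"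
proof -
  have "t\<^sup>2 = t powr 2"
    using assms(1) by simp
  then have "(t\<^sup>2) powr b = t powr (2 * b)"
    by (simp only: powr_powr)
  moreover have "t powr (- a - 2 * b) = 1 / (t powr a * t powr (2 * b))"
    using assms(1) by (simp add: powr_diff powr_minus field_simps)
  ultimately show ?thesis
    using assms by (simp add: powr_mult powr_divide powr_add)
qed

theorem no_viscosity_subsolution:
  fixes \<Omega> :: "(real^('n::{finite,linorder})) set"
  assumes dim: "CARD('n) \<ge> 2" and \<Omega>: "C2_domain \<Omega>" "frontier \<Omega> \<noteq> {}"
    and const: "0 < \<Lambda>" "0 \<le> a" "0 < b" "0 < m"
    and growth: "\<And>A. pos_semidef A \<Longrightarrow>
        F (eigenvalue_vec A) \<le> \<Lambda> * rpow (lambda_min A) a * rpow (lambda_max A) b"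
    and f: "\<And>x. x \<in> \<Omega> \<Longrightarrow> m * infdist x (frontier \<Omega>) powr \<alpha> \<le> f x"
    and alpha: "\<alpha> \<le> - a - 2 * b"
  shows "\<not> viscosity_subsolution F f \<Omega> u"
proof
  assume u: "viscosity_subsolution F f \<Omega> u"
  have "open \<Omega>"
    using \<Omega>(1) by (simp add: C2_domain_def)
  \<comment> \<open>Convexity of the closed domain is part of \<open>convex_on\<close> for
    \<open>u\<close>.\<close>
  have cl: "convex (closure \<Omega>)" "continuous_on (closure \<Omega>) u"
    using u by (auto simp: viscosity_subsolution_def dest: convex_on_imp_convex)
  obtain p e R where p: "p \<in> frontier \<Omega>" and e: "norm e = 1" and R: "R > 0"
    and ball: "ball (p - R *\<^sub>R e) R \<subseteq> \<Omega>"
    and half: "\<And>y. y \<in> closure \<Omega> \<Longrightarrow> e \<bullet> y \<le> e \<bullet> p"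
    using interior_ball_and_halfspace[OF \<Omega> cl(1)] by metis
  define L where "L = 8 / R"
  \<comment> \<open>As \<open>t < 1\<close> below, \<open>\<mu> + \<beta>\<close> is at most
    \<open>M * \<epsilon> / t^2\<close>.\<close>
  define M where "M = 32 + L"
  have LM: "L > 0" "M > 0"
    using R by (auto simp: L_def M_def add_pos_pos)
  \<comment> \<open>Chosen so that the final comparison reads
    \<open>q \<le> \<epsilon> powr (a + b)\<close>; the next choice makes the right-hand side
    \<open>q / 2\<close>, using \<open>a + b > 0\<close>.\<close>
  define q where "q = m * (5/4) powr (- a - 2 * b) / (\<Lambda> * L powr a * M powr b)"
  have q: "q > 0"
    using const LM by (simp add: q_def)
  define \<epsilon> where "\<epsilon> = (q / 2) powr (1 / (a + b))"
  have \<epsilon>: "\<epsilon> > 0"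
    using q by (simp add: \<epsilon>_def)
  have \<epsilon>q: "\<epsilon> powr (a + b) = q / 2"
    using q const by (simp add: \<epsilon>_def powr_powr)
  have "p \<in> closure \<Omega>"
    using p by (simp add: frontier_def)
  then obtain d where d: "d > 0" "\<And>y. y \<in> closure \<Omega> \<Longrightarrow> dist y p < d \<Longrightarrow> dist (u y) (u p) < \<epsilon> / 2"
    using cl(2) \<epsilon> unfolding continuous_on_iff by (metis half_gt_zero)
  \<comment> \<open>The expression bounds the distance from \<open>p\<close> to points of the
    ellipsoid of depth \<open>t\<close>: semi-axis bound plus depth of the centre.\<close>
  have "((\<lambda>t. sqrt (t * R / 4) + t) \<longlongrightarrow> 0) (at_right 0)"
    by (auto intro!: tendsto_eq_intros)
  then have "\<forall>\<^sub>F t in at_right 0. sqrt (t * R / 4) + t < d"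
    using d(1) by (rule order_tendstoD)
  \<comment> \<open>Below \<open>R\<close> the ellipsoid fits into the interior ball; below
    \<open>4/5\<close> the distance bound \<open>5/4 * t\<close> is less than 1.\<close>
  moreover have "\<forall>\<^sub>F t in at_right 0. t < min R (4/5)"
    using R by (intro eventually_at_right_less order_tendstoD(2)[OF tendsto_ident_at]) simp
  moreover have "\<forall>\<^sub>F t::real in at_right 0. 0 < t"
    by (rule eventually_at_right_less)
  ultimately have "\<forall>\<^sub>F t in at_right 0. 0 < t \<and> t < min R (4/5) \<and> sqrt (t * R / 4) + t < d"
    by eventually_elim simp
  then obtain t where t: "0 < t" "t < R" "t < 4/5" "sqrt (t * R / 4) + t < d"
    using eventually_happens[of _ "at_right (0::real)"] by (force simp: trivial_limit_at_right_real)
  define c where "c = p - t *\<^sub>R e"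
  define \<mu> where "\<mu> = L * \<epsilon> / t"
  define \<beta> where "\<beta> = 32 * \<epsilon> / t\<^sup>2"
  have \<mu>\<beta>: "\<mu> > 0" "\<beta> > 0"
    using LM \<epsilon> t by (auto simp: \<mu>_def \<beta>_def)
  let ?A = "stretch \<mu> \<beta> e"
  have region: "(norm (y - c))\<^sup>2 \<le> t * R / 4" "\<bar>e \<bullet> (y - c)\<bar> \<le> t / 4" if "quad ?A c y \<le> \<epsilon>" for y
    using barrier_region[OF t(1) R \<epsilon>] that unfolding \<mu>_def \<beta>_def L_def by blast+
  have E: "{y. quad ?A c y \<le> \<epsilon>} \<subseteq> \<Omega>"
    using barrier_in_ball[OF e t(1)] region t(2) ball unfolding c_def by fastforce
  have near: "dist (u y) (u p) < \<epsilon> / 2" if y: "quad ?A c y \<le> \<epsilon>" for y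
  proof (rule d(2))
    show "y \<in> closure \<Omega>"
      using E y closure_subset by blast
    have "norm (y - c) \<le> sqrt (t * R / 4)"
      using region(1)[OF y] by (rule real_le_rsqrt)
    moreover have "dist c p = t"
      using e t(1) by (simp add: c_def dist_norm)
    ultimately show "dist y p < d"
      using dist_triangle[of y p c] t(4) by (simp add: dist_norm)
  qed
  have "quad ?A c c \<le> \<epsilon>"
    using \<epsilon> by (simp add: quad_def)
  then have osc: "\<bar>u y - u c\<bar> < \<epsilon>" if "quad ?A c y \<le> \<epsilon>" for y
    using near[OF that] near[of c] unfolding dist_real_def by linarith
  obtain x where x: "quad ?A c x < \<epsilon>" "f x \<le> F (eigenvalue_vec ?A)"
    using subsolution_touched_by_quad[OF u \<open>open \<Omega>\<close> _ _ \<epsilon> E osc] \<mu>\<beta> by (metis less_imp_le)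
  have "x \<in> \<Omega>"
    using E x(1) by auto
  define \<delta> where "\<delta> = infdist x (frontier \<Omega>)"
  \<comment> \<open>Positivity of \<open>\<delta>\<close> matters: \<open>powr\<close> is 0 at base
    0, whatever the exponent.\<close>
  have "x \<notin> frontier \<Omega>"
    using \<open>x \<in> \<Omega>\<close> \<open>open \<Omega>\<close> by (simp add: frontier_def interior_open)
  then have "\<delta> > 0"
    using \<Omega>(2) infdist_pos_not_in_closed[of "frontier \<Omega>" x] by (simp add: \<delta>_def)
  have "\<delta> \<le> e \<bullet> p - e \<bullet> x"
    unfolding \<delta>_def by (rule infdist_frontier_le_halfspace[OF \<open>x \<in> \<Omega>\<close> e half])
  also have "\<dots> = t - e \<bullet> (x - c)"
    using e by (simp add: c_def inner_diff_right norm_eq_1)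
  also have "\<dots> \<le> 5/4 * t"
    using region(2)[of x] x(1) by simp
  finally have \<delta>: "\<delta> \<le> 5/4 * t" .
  have "(5/4) powr (- a - 2 * b) * t powr (- a - 2 * b) = (5/4 * t) powr (- a - 2 * b)"
    using t(1) by (simp only: powr_mult)
  \<comment> \<open>With base below 1, lowering the exponent raises the power; then, as
    \<open>\<alpha>\<close> is negative, so does shrinking the base to
    \<open>\<delta>\<close>.\<close>
  also have "\<dots> \<le> (5/4 * t) powr \<alpha>"
    using t alpha by (intro powr_mono') auto
  also have "\<dots> \<le> \<delta> powr \<alpha>"
    using \<delta> \<open>\<delta> > 0\<close> alpha const by (intro powr_mono2') auto
  finally have "m * ((5/4) powr (- a - 2 * b) * t powr (- a - 2 * b)) \<le> m * \<delta> powr \<alpha>"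
    using const by simp
  also have "\<dots> \<le> F (eigenvalue_vec ?A)"
    using f[OF \<open>x \<in> \<Omega>\<close>] x(2) by (simp add: \<delta>_def)
  also have "\<dots> \<le> \<Lambda> * rpow (lambda_min ?A) a * rpow (lambda_max ?A) b"
    using \<mu>\<beta> by (intro growth pos_semidef_stretch) auto
  \<comment> \<open>For positive eigenvalues \<open>rpow\<close> and \<open>powr\<close> agree, also
    when \<open>a = 0\<close>.\<close>
  also have "\<dots> = \<Lambda> * (\<mu> powr a * (\<mu> + \<beta>) powr b)"
    using \<mu>\<beta> by (simp add: lambda_stretch[OF dim e] rpow_def)
  also have "\<dots> \<le> \<Lambda> * (\<mu> powr a * (M * \<epsilon> / t\<^sup>2) powr b)"
  proof -
    have "t\<^sup>2 \<le> t"
      using t by (simp add: power2_eq_square)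
    then have "L * \<epsilon> / t \<le> L * \<epsilon> / t\<^sup>2"
      using LM \<epsilon> t by (intro divide_left_mono) auto
    then have "\<mu> + \<beta> \<le> M * \<epsilon> / t\<^sup>2"
      by (simp add: \<mu>_def \<beta>_def M_def add_divide_distrib distrib_right)
    then show ?thesis
      using const \<mu>\<beta> by (intro mult_left_mono powr_mono2) auto
  qed
  also have "\<dots> = \<Lambda> * (L powr a * M powr b * \<epsilon> powr (a + b)) * t powr (- a - 2 * b)"
    unfolding \<mu>_def using barrier_powers[OF t(1) \<epsilon> LM] by simp
  \<comment> \<open>Both sides carry the same power of \<open>t\<close>, so it cancels and only the
    smallness of \<open>\<epsilon>\<close> decides.\<close>
  finally have "m * (5/4) powr (- a - 2 * b) \<le> \<Lambda> * (L powr a * M powr b * \<epsilon> powr (a + b))"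
    using t(1) by simp
  then have "q \<le> q / 2"
    using const LM unfolding \<epsilon>q by (simp add: q_def field_simps)
  then show False
    using q by simp
qed

theorem theorem1p3:
  fixes \<Omega> :: "(real^('n::{finite,linorder})) set"
    and F g \<phi> :: "(real, 'n) vec \<Rightarrow> real"
    and \<Lambda>\<^sub>0 a b m\<^sub>0 M\<^sub>0 \<alpha> :: real
  assumes dim: "CARD('n) \<ge> 2"
    and A1: "uniformly_convex_C2_domain \<Omega>"
    and A2_cont: "continuous_on UNIV F"
    and A2_mono: "\<And>A B. pos_semidef A \<Longrightarrow> pos_semidef B \<Longrightarrow> pos_semidef (A - B) \<Longrightarrow>
        F (eigenvalue_vec A) \<ge> F (eigenvalue_vec B)"
    and A2_const: "\<Lambda>\<^sub>0 > 0" "a \<ge> 0" "b > 0"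
    and A2_growth: "\<And>A. pos_semidef A \<Longrightarrow>
        F (eigenvalue_vec A) \<le> \<Lambda>\<^sub>0 * rpow (lambda_min A) a * rpow (lambda_max A) b"
    and A3_cont: "continuous_on (closure \<Omega>) g"
    and A3_const: "0 < m\<^sub>0" "m\<^sub>0 \<le> M\<^sub>0"
    and A3_bounds: "\<And>x. x \<in> closure \<Omega> \<Longrightarrow> m\<^sub>0 \<le> g x \<and> g x \<le> M\<^sub>0"
    and A4_cont: "continuous_on (frontier \<Omega>) \<phi>"
    and A4_ext: "\<exists>\<phi>\<^sub>s. convex_on (closure \<Omega>) \<phi>\<^sub>s \<and> continuous_on (closure \<Omega>) \<phi>\<^sub>s \<and>
        (\<forall>x\<in>frontier \<Omega>. \<phi>\<^sub>s x = \<phi> x)"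
    and alpha: "\<alpha> \<le> - a - 2 * b"
  shows "(\<nexists>u. viscosity_solution F (\<lambda>x. g x * infdist x (frontier \<Omega>) powr \<alpha>) \<Omega> \<phi> u) \<and>
         (\<nexists>u. classical_solution F (\<lambda>x. g x * infdist x (frontier \<Omega>) powr \<alpha>) \<Omega> \<phi> u)"
proof -
  let ?f = "\<lambda>x. g x * infdist x (frontier \<Omega>) powr \<alpha>"
  have "\<not> viscosity_subsolution F ?f \<Omega> u" for u
  proof (rule no_viscosity_subsolution[OF dim _ _ A2_const A3_const(1) A2_growth _ alpha])
    show "C2_domain \<Omega>" "frontier \<Omega> \<noteq> {}"
      using A1 by (auto simp: uniformly_convex_C2_domain_def)
    show "m\<^sub>0 * infdist x (frontier \<Omega>) powr \<alpha> \<le> ?f x" if "x \<in> \<Omega>" for x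
      using A3_bounds[of x] that closure_subset[of \<Omega>] by (intro mult_right_mono) auto
  qed
  moreover have "viscosity_subsolution F ?f \<Omega> u" if "classical_solution F ?f \<Omega> \<phi> u" for u
    using A2_mono that by (rule classical_solution_imp_viscosity_subsolution)
  ultimately show ?thesis
    by (auto simp: viscosity_solution_def)
qed

end
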